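(* If $(X,\tau)$ is a compact Hausdorff space and $\sigma$ is strictly finer than $\tau$, then there exists at least one free (maximal) ideal in $B_1(X,\tau)$.
   Context: $B_1(X,\tau)$ is the ring of Baire one functions on $(X,\tau)$, i.e. pointwise limits of sequences of $\tau$-continuous functions $X\to\mathbb{R}$. For $f\in B_1(X,\tau)$, $Z(f)=\{x\in X: f(x)=0\}$. The topology $\sigma$ on $X$ is the one having $\{Z(f): f\in B_1(X,\tau)\}$ as a base for closed sets; it always contains $\tau$. A (proper) ideal $I$ of $B_1(X,\tau)$ is free if $\bigcap_{f\in I}Z(f)=\emptyset$, and fixed otherwise. *)

theory Defs
  imports "HOL-Analysis.Analysis" "HOL-Algebra.Ideal"
begin

text \<open>Functions on the space are represented extensionally: they take the value
  \<^term>\<open>undefined\<close> outside the underlying set, so that equality of Baire one functions is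
  equality on the space.\<close>

definition baire_one :: "'a topology \<Rightarrow> ('a \<Rightarrow> real) set" where
  "baire_one X = {f \<in> extensional (topspace X).
     \<exists>F :: nat \<Rightarrow> 'a \<Rightarrow> real. (\<forall>n. continuous_map X euclideanreal (F n)) \<and>
       (\<forall>x\<in>topspace X. (\<lambda>n. F n x) \<longlonglongrightarrow> f x)}"

definition baire_one_ring :: "'a topology \<Rightarrow> ('a \<Rightarrow> real) ring" where
  "baire_one_ring X =
    \<lparr>carrier = baire_one X,
     monoid.mult = (\<lambda>f g. \<lambda>x\<in>topspace X. f x * g x),
     one = (\<lambda>x\<in>topspace X. 1),
     zero = (\<lambda>x\<in>topspace X. 0),
     add = (\<lambda>f g. \<lambda>x\<in>topspace X. f x + g x)\<rparr>"

definition zero_set :: "'a topology \<Rightarrow> ('a \<Rightarrow> real) \<Rightarrow> 'a set" where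
  "zero_set X f = {x \<in> topspace X. f x = 0}"

text \<open>The zero sets form a base for the closed sets, so their complements form a base for the
  open sets; see \<open>closedin_sigma\<close> below.\<close>

definition sigma_topology :: "'a topology \<Rightarrow> 'a topology" where
  "sigma_topology X =
     topology (arbitrary union_of (\<lambda>U. \<exists>f\<in>baire_one X. U = topspace X - zero_set X f))"

definition free_ideal :: "'a topology \<Rightarrow> ('a \<Rightarrow> real) set \<Rightarrow> bool" where
  "free_ideal X I \<longleftrightarrow>
     ideal I (baire_one_ring X) \<and> I \<noteq> carrier (baire_one_ring X) \<and>
     (\<Inter>f\<in>I. zero_set X f) = {}"

lemma baire_one_const: "(\<lambda>x\<in>topspace X. c) \<in> baire_one X"
  unfolding baire_one_def
  by (auto intro!: exI[of _ "\<lambda>n x. c"])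

lemma baire_one_add:
  assumes "f \<in> baire_one X" "g \<in> baire_one X"
  shows "(\<lambda>x\<in>topspace X. f x + g x) \<in> baire_one X"
proof -
  obtain F G where
    "\<forall>n. continuous_map X euclideanreal (F n)" "\<forall>x\<in>topspace X. (\<lambda>n. F n x) \<longlonglongrightarrow> f x"
    "\<forall>n. continuous_map X euclideanreal (G n)" "\<forall>x\<in>topspace X. (\<lambda>n. G n x) \<longlonglongrightarrow> g x"
    using assms unfolding baire_one_def by blast
  then show ?thesis
    unfolding baire_one_def
    by (auto intro!: exI[of _ "\<lambda>n x. F n x + G n x"] continuous_map_add tendsto_add)
qed

lemma baire_one_mult:
  assumes "f \<in> baire_one X" "g \<in> baire_one X"
  shows "(\<lambda>x\<in>topspace X. f x * g x) \<in> baire_one X"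
proof -
  obtain F G where
    "\<forall>n. continuous_map X euclideanreal (F n)" "\<forall>x\<in>topspace X. (\<lambda>n. F n x) \<longlonglongrightarrow> f x"
    "\<forall>n. continuous_map X euclideanreal (G n)" "\<forall>x\<in>topspace X. (\<lambda>n. G n x) \<longlonglongrightarrow> g x"
    using assms unfolding baire_one_def by blast
  then show ?thesis
    unfolding baire_one_def
    by (auto intro!: exI[of _ "\<lambda>n x. F n x * G n x"] continuous_map_real_mult tendsto_mult)
qed

lemma cring_baire_one_ring: "cring (baire_one_ring X)"
proof (rule cringI)
  have ext: "f \<in> extensional (topspace X)" if "f \<in> baire_one X" for f
    using that by (simp add: baire_one_def)
  show "abelian_group (baire_one_ring X)"
  proof (rule abelian_groupI)
    fix f assume f: "f \<in> carrier (baire_one_ring X)"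
    then have "(\<lambda>x\<in>topspace X. (\<lambda>x\<in>topspace X. -1) x * f x) \<in> baire_one X"
      by (intro baire_one_mult baire_one_const) (simp add: baire_one_ring_def)
    then show "\<exists>g\<in>carrier (baire_one_ring X). g \<oplus>\<^bsub>baire_one_ring X\<^esub> f = \<zero>\<^bsub>baire_one_ring X\<^esub>"
      by (rule_tac bexI) (auto simp: baire_one_ring_def intro!: restrict_ext)
  qed (auto simp: baire_one_ring_def baire_one_add baire_one_const algebra_simps
        intro!: restrict_ext dest: ext extensional_restrict
        cong: restrict_cong)
  show "Group.comm_monoid (baire_one_ring X)"
    by (rule comm_monoidI)
       (auto simp: baire_one_ring_def baire_one_mult baire_one_const algebra_simps
        intro!: restrict_ext dest: ext extensional_restrict
        cong: restrict_cong)
qed (auto simp: baire_one_ring_def algebra_simps intro!: restrict_ext)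

lemma zero_set_Un:
  assumes "f \<in> baire_one X" "g \<in> baire_one X"
  shows "\<exists>h\<in>baire_one X. zero_set X h = zero_set X f \<union> zero_set X g"
  using baire_one_mult[OF assms] by (rule rev_bexI) (auto simp: zero_set_def)

lemma openin_sigma:
  "openin (sigma_topology X) =
     arbitrary union_of (\<lambda>U. \<exists>f\<in>baire_one X. U = topspace X - zero_set X f)"
proof -
  let ?P = "\<lambda>U. \<exists>f\<in>baire_one X. U = topspace X - zero_set X f"
  have "?P (S \<inter> T)" if S: "?P S" and T: "?P T" for S T
  proof -
    from S T obtain f g where "f \<in> baire_one X" "g \<in> baire_one X"
      and ST: "S = topspace X - zero_set X f" "T = topspace X - zero_set X g" by blast
    then obtain h where "h \<in> baire_one X" "zero_set X h = zero_set X f \<union> zero_set X g"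
      using zero_set_Un by blast
    with ST show ?thesis by blast
  qed
  then have "istopology (arbitrary union_of ?P)"
    by (rule istopology_base)
  then show ?thesis
    by (simp add: sigma_topology_def topology_inverse')
qed

lemma topspace_sigma [simp]: "topspace (sigma_topology X) = topspace X"
proof
  show "topspace (sigma_topology X) \<subseteq> topspace X"
    unfolding topspace_def[of "sigma_topology X"] openin_sigma union_of_def by blast
  have "topspace X - zero_set X (\<lambda>x\<in>topspace X. 1) = topspace X"
    by (auto simp: zero_set_def)
  then have "openin (sigma_topology X) (topspace X)"
    unfolding openin_sigma
    by (intro arbitrary_union_of_inc bexI[OF _ baire_one_const[of 1 X]]) simp
  then show "topspace X \<subseteq> topspace (sigma_topology X)"
    by (rule openin_subset)
qed

lemma closedin_sigma:
  "closedin (sigma_topology X) C \<longleftrightarrow>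
     (\<exists>\<F>\<subseteq>baire_one X. C = topspace X \<inter> (\<Inter>f\<in>\<F>. zero_set X f))"
proof
  assume C: "closedin (sigma_topology X) C"
  have sub: "C \<subseteq> topspace X"
    using closedin_subset[OF C] by simp
  have "openin (sigma_topology X) (topspace X - C)"
    using C by (simp add: closedin_def)
  then obtain \<U> where sub\<U>: "\<U> \<subseteq> {U. \<exists>f\<in>baire_one X. U = topspace X - zero_set X f}"
    and Union: "\<Union>\<U> = topspace X - C"
    unfolding openin_sigma union_of_def by (elim exE conjE) (rule that, assumption+)
  have U: "\<exists>f\<in>baire_one X. U = topspace X - zero_set X f" if "U \<in> \<U>" for U
    using subsetD[OF sub\<U> that] by simp
  note eq = Union[symmetric]
  define \<F> where "\<F> = {f \<in> baire_one X. topspace X - zero_set X f \<in> \<U>}"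
  have "C = topspace X \<inter> (\<Inter>f\<in>\<F>. zero_set X f)"
  proof (intro equalityI subsetI)
    fix x assume x: "x \<in> C"
    have "x \<in> zero_set X f" if "f \<in> \<F>" for f
    proof (rule ccontr)
      assume "x \<notin> zero_set X f"
      then have "x \<in> topspace X - zero_set X f"
        using x sub by blast
      moreover have "topspace X - zero_set X f \<in> \<U>"
        using that by (simp add: \<F>_def)
      ultimately have "x \<in> \<Union>\<U>" by blast
      with eq x show False by blast
    qed
    with x sub show "x \<in> topspace X \<inter> (\<Inter>f\<in>\<F>. zero_set X f)" by blast
  next
    fix x assume x: "x \<in> topspace X \<inter> (\<Inter>f\<in>\<F>. zero_set X f)"
    show "x \<in> C"
    proof (rule ccontr)
      assume "x \<notin> C"
      with x have "x \<in> \<Union>\<U>" using eq by blast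
      then obtain U where "U \<in> \<U>" "x \<in> U" by blast
      moreover obtain f where "f \<in> baire_one X" "U = topspace X - zero_set X f"
        using U[OF \<open>U \<in> \<U>\<close>] by blast
      ultimately have "f \<in> \<F>" "x \<notin> zero_set X f" by (simp_all add: \<F>_def)
      with x show False by blast
    qed
  qed
  then show "\<exists>\<F>\<subseteq>baire_one X. C = topspace X \<inter> (\<Inter>f\<in>\<F>. zero_set X f)"
    unfolding \<F>_def by blast
next
  assume "\<exists>\<F>\<subseteq>baire_one X. C = topspace X \<inter> (\<Inter>f\<in>\<F>. zero_set X f)"
  then obtain \<F> where F: "\<F> \<subseteq> baire_one X" and C: "C = topspace X \<inter> (\<Inter>f\<in>\<F>. zero_set X f)"
    by blast
  have "topspace X - C = \<Union>((\<lambda>f. topspace X - zero_set X f) ` \<F>)"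
    using C by blast
  moreover have "openin (sigma_topology X) (\<Union>((\<lambda>f. topspace X - zero_set X f) ` \<F>))"
    using F unfolding openin_sigma
    by (intro arbitrary_union_of_Union) (auto intro!: arbitrary_union_of_inc)
  ultimately show "closedin (sigma_topology X) C"
    using C by (auto simp: closedin_def)
qed

end

theory Submission
  imports Defs "HOL-Algebra.Ring_Divisibility"
begin

text \<open>Let \<open>\<tau>\<close> be the given topology and \<open>\<sigma>\<close> the one based on the zero sets. If \<open>\<sigma>\<close> were
  compact, the identity from it to the coarser Hausdorff topology \<open>\<tau>\<close> would be a continuous,
  hence closed, bijection, and the two topologies would coincide
  (\<open>compact_finer_than_Hausdorff_eq\<close>). So \<open>\<sigma>\<close> is not compact: some family \<open>\<C>\<close> of
  \<open>\<sigma>\<close>-closed sets has the finite intersection property but empty intersection.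

  The Baire one functions that vanish on some finite intersection of members of \<open>\<C>\<close> form
  an ideal (\<open>ideal_vanishing\<close>). It omits the constant 1, because those finite intersections
  are nonempty. It is free, because every \<open>\<sigma>\<close>-closed set is an intersection of zero sets, so
  that a common zero of the ideal would lie in every member of \<open>\<C>\<close>. By Zorn's lemma the
  ideal extends to a maximal one (\<open>exists_maximalideal_superset\<close>), and enlarging an ideal
  only shrinks its set of common zeros.\<close>

text \<open>Properness survives unions of chains because an ideal is proper exactly when it
  omits the unit.\<close>

lemma (in ring) exists_maximalideal_superset:
  assumes I: "ideal I R" and proper: "I \<noteq> carrier R"
  shows "\<exists>M. maximalideal M R \<and> I \<subseteq> M"
proof -
  define \<A> where "\<A> = {J. ideal J R \<and> I \<subseteq> J \<and> \<one> \<notin> J}"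
  have one_notin: "\<one> \<notin> J \<longleftrightarrow> J \<noteq> carrier R" if "ideal J R" for J
    using ideal.one_imp_carrier[OF that] by blast
  have "\<exists>M\<in>\<A>. \<forall>J\<in>\<A>. M \<subseteq> J \<longrightarrow> J = M"
  proof (rule subset_Zorn_nonempty)
    show "\<A> \<noteq> {}"
      using I proper one_notin by (auto simp: \<A>_def)
    fix \<C> assume "\<C> \<noteq> {}" and chain: "subset.chain \<A> \<C>"
    then have mem: "ideal J R" "I \<subseteq> J" "\<one> \<notin> J" if "J \<in> \<C>" for J
      using that by (auto simp: \<A>_def subset.chain_def)
    have "subset.chain {J. ideal J R} \<C>"
      using chain by (auto simp: \<A>_def subset.chain_def)
    then have "ideal (\<Union>\<C>) R"
      using chain_Union_is_ideal \<open>\<C> \<noteq> {}\<close> by presburger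
    moreover have "I \<subseteq> \<Union>\<C>"
      using mem(2) \<open>\<C> \<noteq> {}\<close> by blast
    ultimately show "\<Union>\<C> \<in> \<A>"
      using mem(3) by (auto simp: \<A>_def)
  qed
  then obtain M where M: "ideal M R" "I \<subseteq> M" "\<one> \<notin> M"
    and max: "\<And>J. \<lbrakk>ideal J R; I \<subseteq> J; \<one> \<notin> J; M \<subseteq> J\<rbrakk> \<Longrightarrow> J = M"
    by (auto simp: \<A>_def)
  have "maximalideal M R"
  proof (rule maximalidealI[OF M(1)])
    show "carrier R \<noteq> M"
      using M(3) by blast
    show "J = M \<or> J = carrier R" if "ideal J R" "M \<subseteq> J" for J
      using max[OF that(1) _ _ that(2)] M(2) that one_notin by blast
  qed
  with M(2) show ?thesis by blast
qed

text \<open>Downward directedness of \<open>\<B>\<close> is what closes the ideal under sums: two functions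
  vanishing on different members both vanish on a common smaller one.\<close>

lemma ideal_vanishing:
  assumes "\<B> \<noteq> {}" and sub: "\<And>B. B \<in> \<B> \<Longrightarrow> B \<subseteq> topspace X"
    and directed: "\<And>B C. \<lbrakk>B \<in> \<B>; C \<in> \<B>\<rbrakk> \<Longrightarrow> \<exists>D\<in>\<B>. D \<subseteq> B \<inter> C"
  shows "ideal {f \<in> baire_one X. \<exists>B\<in>\<B>. B \<subseteq> zero_set X f} (baire_one_ring X)"
    (is "ideal ?I ?R")
proof -
  interpret cring ?R
    by (rule cring_baire_one_ring)
  have carrier: "carrier ?R = baire_one X"
    and add: "f \<oplus>\<^bsub>?R\<^esub> g = (\<lambda>x\<in>topspace X. f x + g x)"
    and mult: "f \<otimes>\<^bsub>?R\<^esub> g = (\<lambda>x\<in>topspace X. f x * g x)"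
    and zero: "\<zero>\<^bsub>?R\<^esub> = (\<lambda>x\<in>topspace X. 0)" for f g
    by (simp_all add: baire_one_ring_def)
  have mult_closed: "g \<otimes>\<^bsub>?R\<^esub> f \<in> ?I" if "f \<in> ?I" "g \<in> carrier ?R" for f g
  proof -
    have "zero_set X f \<subseteq> zero_set X (g \<otimes>\<^bsub>?R\<^esub> f)"
      by (auto simp: zero_set_def mult)
    moreover have "g \<otimes>\<^bsub>?R\<^esub> f \<in> baire_one X"
      using that m_closed[of g f] by (simp add: carrier)
    ultimately show ?thesis
      using that by blast
  qed
  have sum_closed: "f \<oplus>\<^bsub>?R\<^esub> g \<in> ?I" if fg: "f \<in> ?I" "g \<in> ?I" for f g
  proof -
    obtain B C where BC: "B \<in> \<B>" "C \<in> \<B>" "B \<subseteq> zero_set X f" "C \<subseteq> zero_set X g"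
      using fg by blast
    then obtain D where "D \<in> \<B>" "D \<subseteq> B \<inter> C"
      using directed by blast
    moreover have "zero_set X f \<inter> zero_set X g \<subseteq> zero_set X (f \<oplus>\<^bsub>?R\<^esub> g)"
      by (auto simp: zero_set_def add)
    moreover have "f \<oplus>\<^bsub>?R\<^esub> g \<in> baire_one X"
      using fg a_closed[of f g] by (simp add: carrier)
    ultimately show ?thesis
      using BC by blast
  qed
  have neg_closed: "\<ominus>\<^bsub>?R\<^esub> f \<in> ?I" if "f \<in> ?I" for f
  proof -
    have "f \<in> carrier ?R"
      using that by (simp add: carrier)
    then have "(\<ominus>\<^bsub>?R\<^esub> \<one>\<^bsub>?R\<^esub>) \<otimes>\<^bsub>?R\<^esub> f = \<ominus>\<^bsub>?R\<^esub> f"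
      by (simp add: l_minus)
    with mult_closed[OF that a_inv_closed[OF one_closed]] show ?thesis
      by (simp only:)
  qed
  obtain B where "B \<in> \<B>"
    using \<open>\<B> \<noteq> {}\<close> by blast
  moreover have "zero_set X \<zero>\<^bsub>?R\<^esub> = topspace X"
    by (auto simp: zero_set_def zero)
  moreover have "\<zero>\<^bsub>?R\<^esub> \<in> baire_one X"
    using zero_closed unfolding carrier .
  ultimately have zero_in: "\<zero>\<^bsub>?R\<^esub> \<in> ?I"
    using sub by blast
  show ?thesis
  proof (rule idealI[OF ring_axioms])
    show "subgroup ?I (add_monoid ?R)"
    proof (rule add.subgroupI)
      show "?I \<subseteq> carrier ?R"
        unfolding carrier by blast
      show "?I \<noteq> {}"
        using zero_in by blast
    qed (fact neg_closed sum_closed)+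
    show "g \<otimes>\<^bsub>?R\<^esub> f \<in> ?I" if "f \<in> ?I" "g \<in> carrier ?R" for f g
      by (rule mult_closed[OF that])
    show "f \<otimes>\<^bsub>?R\<^esub> g \<in> ?I" if "f \<in> ?I" "g \<in> carrier ?R" for f g
      using mult_closed[OF that] m_comm[of f g] that by (simp add: carrier)
  qed
qed

lemma compact_finer_than_Hausdorff_eq:
  assumes "compact_space Y" and "Hausdorff_space X" and top: "topspace Y = topspace X"
    and finer: "\<And>U. openin X U \<Longrightarrow> openin Y U"
  shows "Y = X"
proof -
  have "continuous_map Y X id"
    using finer openin_subset[of X] top
    by (auto simp: continuous_map_def Int_absorb1 Collect_conj_eq)
  then have "closed_map Y X id"
    using assms(1,2) by (rule continuous_imp_closed_map)
  then have closed: "closedin X C" if "closedin Y C" for C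
    using that by (simp add: closed_map_def)
  have "openin X U" if "openin Y U" for U
  proof -
    have "closedin X (topspace X - U)"
      using closed[of "topspace X - U"] that top by (metis closedin_diff closedin_topspace)
    with openin_subset[OF that] top show ?thesis
      by (simp add: openin_closedin_eq)
  qed
  with finer show ?thesis
    by (auto simp: topology_eq)
qed

lemma free_ideal_mono:
  assumes "free_ideal X I" "I \<subseteq> J" "ideal J (baire_one_ring X)" "J \<noteq> carrier (baire_one_ring X)"
  shows "free_ideal X J"
  using assms unfolding free_ideal_def by blast

text \<open>A family of closed sets witnessing noncompactness turns into a filter base of finite
  intersections: nonemptiness of these makes the associated ideal proper, emptiness of the
  total intersection makes it free.\<close>

lemma exists_free_ideal_of_noncompact_sigma:
  assumes "\<not> compact_space (sigma_topology X)"
  shows "\<exists>I. free_ideal X I"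
proof -
  obtain \<C> where closed: "\<And>C. C \<in> \<C> \<Longrightarrow> closedin (sigma_topology X) C"
    and fip: "\<And>\<F>. \<lbrakk>finite \<F>; \<F> \<subseteq> \<C>\<rbrakk> \<Longrightarrow> \<Inter>\<F> \<noteq> {}" and empty: "\<Inter>\<C> = {}"
    using assms unfolding compact_space_fip not_all not_imp not_not by (elim exE conjE) metis
  have sub: "C \<subseteq> topspace X" if "C \<in> \<C>" for C
    using closedin_subset[OF closed[OF that]] by simp
  \<comment> \<open>The empty subfamily is left out because its intersection is the whole type
    rather than the space.\<close>
  define \<B> where "\<B> = {\<Inter>\<F> | \<F>. finite \<F> \<and> \<F> \<noteq> {} \<and> \<F> \<subseteq> \<C>}"
  have \<C>_\<B>: "C \<in> \<B>" if "C \<in> \<C>" for C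
    unfolding \<B>_def using that by (intro CollectI exI[of _ "{C}"]) auto
  have ne: "B \<noteq> {}" if "B \<in> \<B>" for B
    using that fip by (auto simp: \<B>_def)
  have sub_\<B>: "B \<subseteq> topspace X" if "B \<in> \<B>" for B
    using that sub by (fastforce simp: \<B>_def)
  have directed: "\<exists>D\<in>\<B>. D \<subseteq> B \<inter> C" if "B \<in> \<B>" "C \<in> \<B>" for B C
  proof -
    obtain \<F> \<G> where "B = \<Inter>\<F>" "finite \<F>" "\<F> \<noteq> {}" "\<F> \<subseteq> \<C>" "C = \<Inter>\<G>" "finite \<G>" "\<G> \<subseteq> \<C>"
      using \<open>B \<in> \<B>\<close> \<open>C \<in> \<B>\<close> unfolding \<B>_def by blast
    then have "\<Inter>(\<F> \<union> \<G>) \<in> \<B>" "\<Inter>(\<F> \<union> \<G>) \<subseteq> B \<inter> C"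
      unfolding \<B>_def by (blast intro: finite_UnI)+
    then show ?thesis by blast
  qed
  define I where "I = {f \<in> baire_one X. \<exists>B\<in>\<B>. B \<subseteq> zero_set X f}"
  have "\<C> \<noteq> {}"
    using empty by auto
  then have "\<B> \<noteq> {}"
    using \<C>_\<B> by blast
  then have "ideal I (baire_one_ring X)"
    unfolding I_def using sub_\<B> directed by (rule ideal_vanishing)
  moreover have "I \<noteq> carrier (baire_one_ring X)"
  proof
    assume "I = carrier (baire_one_ring X)"
    then have "(\<lambda>x\<in>topspace X. 1) \<in> I"
      by (simp add: baire_one_ring_def baire_one_const)
    moreover have "zero_set X (\<lambda>x\<in>topspace X. 1) = {}"
      by (auto simp: zero_set_def)
    ultimately show False
      using ne by (auto simp: I_def)
  qed
  moreover have "(\<Inter>f\<in>I. zero_set X f) = {}"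
  proof -
    have "x \<in> C" if x: "x \<in> (\<Inter>f\<in>I. zero_set X f)" and "C \<in> \<C>" for x C
    proof -
      obtain \<F> where \<F>: "\<F> \<subseteq> baire_one X" and C: "C = topspace X \<inter> (\<Inter>f\<in>\<F>. zero_set X f)"
        using closed[OF \<open>C \<in> \<C>\<close>] unfolding closedin_sigma by blast
      have "f \<in> I" if "f \<in> \<F>" for f
      proof -
        have "C \<subseteq> zero_set X f"
          using that C by blast
        then show ?thesis
          using that \<F> \<C>_\<B>[OF \<open>C \<in> \<C>\<close>] by (auto simp: I_def)
      qed
      \<comment> \<open>The zero function puts common zeros inside the space, also when \<open>\<F>\<close> is empty.\<close>
      moreover have "(\<lambda>x\<in>topspace X. 0) \<in> I"
      proof -
        have "C \<subseteq> zero_set X (\<lambda>x\<in>topspace X. 0)"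
          using sub[OF \<open>C \<in> \<C>\<close>] by (auto simp: zero_set_def)
        then show ?thesis
          using \<C>_\<B>[OF \<open>C \<in> \<C>\<close>] baire_one_const[of 0 X] by (auto simp: I_def)
      qed
      then have "x \<in> topspace X"
        using x by (auto simp: zero_set_def)
      ultimately show "x \<in> C"
        using x C by blast
    qed
    with empty show ?thesis by blast
  qed
  ultimately show ?thesis
    unfolding free_ideal_def by blast
qed

theorem theorem4p14:
  fixes X :: "'a topology"
  assumes "compact_space X" and "Hausdorff_space X"
    and "{U. openin X U} \<subset> {U. openin (sigma_topology X) U}"
  shows "\<exists>M. free_ideal X M \<and> maximalideal M (baire_one_ring X)"
proof -
  interpret cring "baire_one_ring X"
    by (rule cring_baire_one_ring)
  have "\<not> compact_space (sigma_topology X)"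
  proof
    assume "compact_space (sigma_topology X)"
    then have "sigma_topology X = X"
      using assms(2,3) by (intro compact_finer_than_Hausdorff_eq) auto
    with assms(3) show False by simp
  qed
  then obtain I where I: "free_ideal X I"
    using exists_free_ideal_of_noncompact_sigma by blast
  then obtain M where M: "maximalideal M (baire_one_ring X)" "I \<subseteq> M"
    using exists_maximalideal_superset unfolding free_ideal_def by blast
  interpret M: maximalideal M "baire_one_ring X"
    by (rule M(1))
  have "free_ideal X M"
    using free_ideal_mono[OF I M(2) M.is_ideal] M.I_notcarr by blast
  with M(1) show ?thesis by blast
qed

end
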